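(* Let $m,n\in\mathbb{N}$ and let $u\in\mathcal{S}'(\mathbb{T}^m\times\mathbb{R}^n)$. Then there exist $C,N>0$ such that $$|\langle\widehat{u}(k,x),f(x)\rangle|\leq C\,\tilde{p}_N(f)\,(1+|k|^2)^{N/2}$$ for every $f\in\mathcal{S}(\mathbb{R}^n)$ and every $k\in\mathbb{Z}^m$, where $\tilde{p}_N(f)=\sum_{|\alpha|+|\gamma|\leq N}\|x^\gamma\partial^\alpha f\|_\infty$ (sum over $\alpha,\gamma\in\mathbb{N}_0^n$).
   Context: $\mathbb{T}^m=(\mathbb{R}/2\pi\mathbb{Z})^m$, with variables $(t,x)\in\mathbb{T}^m\times\mathbb{R}^n$; $\mathbb{N}_0$ denotes the nonnegative integers; $\mathcal{S}(\mathbb{R}^n)$ is the usual Schwartz space. $\mathcal{S}(\mathbb{T}^m\times\mathbb{R}^n)$ is the Fréchet space of all $f\in C^\infty(\mathbb{T}^m\times\mathbb{R}^n)$ such that $\|f\|_{\alpha,\beta,\gamma}:=\sup_{(t,x)}|x^\gamma\partial_t^\alpha\partial_x^\beta f(t,x)|<+\infty$ for all $\alpha\in\mathbb{N}_0^m$, $\beta,\gamma\in\mathbb{N}_0^n$, with seminorms $p_N(f):=\sum_{|\alpha|+|\beta|+|\gamma|\leq N}\|f\|_{\alpha,\beta,\gamma}$. $\mathcal{S}'(\mathbb{T}^m\times\mathbb{R}^n)$ is its dual: the linear functionals $u:\mathcal{S}(\mathbb{T}^m\times\mathbb{R}^n)\to\mathbb{C}$ for which there are $C,N>0$ with $|\langle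 u,f\rangle|\leq Cp_N(f)$ for all $f$. For $u\in\mathcal{S}'(\mathbb{T}^m\times\mathbb{R}^n)$ and $k\in\mathbb{Z}^m$, the partial Fourier coefficient $\widehat{u}(k,\cdot)=\mathcal{F}_{\mathbb{T}^m}(u)(k,\cdot)\in\mathcal{S}'(\mathbb{R}^n)$ is defined by $\langle\widehat{u}(k,x),f(x)\rangle=\frac{1}{(2\pi)^m}\langle u(t,x),e^{-ik\cdot t}f(x)\rangle$ for $f\in\mathcal{S}(\mathbb{R}^n)$. *)

theory Defs
  imports "HOL-Analysis.Analysis"
begin

section \<open>Smooth functions and partial derivatives\<close>

definition dir_deriv :: "'a::real_normed_vector \<Rightarrow> ('a \<Rightarrow> complex) \<Rightarrow> 'a \<Rightarrow> complex" where
  "dir_deriv v f = (\<lambda>z. frechet_derivative f (at z) v)"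

text \<open>On a Euclidean space this is the usual class of functions whose partial derivatives up to order
  \<open>k\<close> all exist and are continuous.\<close>

primrec Ck :: "nat \<Rightarrow> ('a::euclidean_space \<Rightarrow> complex) \<Rightarrow> bool" where
  "Ck 0 f \<longleftrightarrow> continuous_on UNIV f"
| "Ck (Suc k) f \<longleftrightarrow> (\<forall>z. f differentiable (at z)) \<and> (\<forall>v. Ck k (dir_deriv v f))"

definition smooth :: "('a::euclidean_space \<Rightarrow> complex) \<Rightarrow> bool" where
  "smooth f \<longleftrightarrow> (\<forall>k. Ck k f)"

text \<open>A multi-index of length \<open>d = CARD('d)\<close> is a vector of type \<open>nat ^ 'd\<close>.\<close>

definition mi_size :: "nat ^ 'd::finite \<Rightarrow> nat" where
  "mi_size \<alpha> = (\<Sum>i\<in>UNIV. \<alpha> $ i)"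

definition monomial :: "nat ^ 'd::finite \<Rightarrow> real ^ 'd \<Rightarrow> real" where
  "monomial \<gamma> x = (\<Prod>i\<in>UNIV. (x $ i) ^ (\<gamma> $ i))"

text \<open>A finite index type carries no order, so an enumeration of the coordinates is chosen. It fixes
  the order in which partial derivatives are taken, which is immaterial for smooth functions.\<close>

definition coords :: "'d::finite list" where
  "coords = (SOME is. distinct is \<and> set is = UNIV)"

text \<open>\<open>mi_deriv e \<alpha> f\<close> applies the derivative in direction \<open>e i\<close> exactly \<open>\<alpha> $ i\<close> times, for every \<open>i\<close>.\<close>

definition mi_deriv ::
    "('d::finite \<Rightarrow> 'a::real_normed_vector) \<Rightarrow> nat ^ 'd \<Rightarrow> ('a \<Rightarrow> complex) \<Rightarrow> 'a \<Rightarrow> complex" where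
  "mi_deriv e \<alpha> f = fold (\<lambda>i. dir_deriv (e i) ^^ (\<alpha> $ i)) coords f"

definition deriv_sp :: "nat ^ 'n::finite \<Rightarrow> (real ^ 'n \<Rightarrow> complex) \<Rightarrow> real ^ 'n \<Rightarrow> complex" where
  "deriv_sp = mi_deriv (\<lambda>i. axis i 1)"

definition deriv_t ::
    "nat ^ 'm::finite \<Rightarrow> ((real ^ 'm) \<times> (real ^ 'n::finite) \<Rightarrow> complex) \<Rightarrow> (real ^ 'm) \<times> (real ^ 'n) \<Rightarrow> complex" where
  "deriv_t = mi_deriv (\<lambda>i. (axis i 1, 0))"

definition deriv_x ::
    "nat ^ 'n::finite \<Rightarrow> ((real ^ 'm::finite) \<times> (real ^ 'n) \<Rightarrow> complex) \<Rightarrow> (real ^ 'm) \<times> (real ^ 'n) \<Rightarrow> complex" where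
  "deriv_x = mi_deriv (\<lambda>i. (0, axis i 1))"


section \<open>Schwartz functions on Euclidean space\<close>

definition schwartz :: "(real ^ 'n::finite \<Rightarrow> complex) set" where
  "schwartz = {f. smooth f \<and>
     (\<forall>\<alpha> \<gamma>. bdd_above (range (\<lambda>x. norm (monomial \<gamma> x *\<^sub>R deriv_sp \<alpha> f x))))}"

definition p_tilde :: "nat \<Rightarrow> (real ^ 'n::finite \<Rightarrow> complex) \<Rightarrow> real" where
  "p_tilde N f = (\<Sum>(\<alpha>, \<gamma>)\<in>{(\<alpha>, \<gamma>). mi_size \<alpha> + mi_size \<gamma> \<le> N}.
     (SUP x. norm (monomial \<gamma> x *\<^sub>R deriv_sp \<alpha> f x)))"


section \<open>Schwartz functions and tempered distributions on torus times Euclidean space\<close>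

definition int_vec :: "int ^ 'm::finite \<Rightarrow> real ^ 'm" where
  "int_vec k = (\<chi> i. of_int (k $ i))"

text \<open>A function on \<open>(\<real>/2\<pi>\<int>)\<^sup>m \<times> \<real>\<^sup>n\<close> is represented by its lift to \<open>\<real>\<^sup>m \<times> \<real>\<^sup>n\<close>, which is
  \<open>2\<pi>\<int>\<^sup>m\<close>-periodic in the first variable. Smoothness, derivatives and suprema are those of the lift.\<close>

definition torus_periodic :: "((real ^ 'm::finite) \<times> (real ^ 'n::finite) \<Rightarrow> complex) \<Rightarrow> bool" where
  "torus_periodic f \<longleftrightarrow> (\<forall>t x k. f (t + (2 * pi) *\<^sub>R int_vec k, x) = f (t, x))"

definition schwartz_torus :: "((real ^ 'm::finite) \<times> (real ^ 'n::finite) \<Rightarrow> complex) set" where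
  "schwartz_torus = {f. torus_periodic f \<and> smooth f \<and>
     (\<forall>\<alpha> \<beta> \<gamma>. bdd_above (range (\<lambda>(t, x). norm (monomial \<gamma> x *\<^sub>R deriv_t \<alpha> (deriv_x \<beta> f) (t, x)))))}"

definition seminorm_torus ::
    "nat ^ 'm::finite \<Rightarrow> nat ^ 'n::finite \<Rightarrow> nat ^ 'n \<Rightarrow> ((real ^ 'm) \<times> (real ^ 'n) \<Rightarrow> complex) \<Rightarrow> real" where
  "seminorm_torus \<alpha> \<beta> \<gamma> f = (SUP (t, x). norm (monomial \<gamma> x *\<^sub>R deriv_t \<alpha> (deriv_x \<beta> f) (t, x)))"

definition p_torus :: "nat \<Rightarrow> ((real ^ 'm::finite) \<times> (real ^ 'n::finite) \<Rightarrow> complex) \<Rightarrow> real" where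
  "p_torus N f = (\<Sum>(\<alpha>, \<beta>, \<gamma>)\<in>{(\<alpha>, \<beta>, \<gamma>). mi_size \<alpha> + mi_size \<beta> + mi_size \<gamma> \<le> N}.
     seminorm_torus \<alpha> \<beta> \<gamma> f)"

text \<open>A functional on the Schwartz space is a total function on all functions, of which only the
  values on \<open>schwartz_torus\<close> matter.\<close>

definition tempered_torus :: "(((real ^ 'm::finite) \<times> (real ^ 'n::finite) \<Rightarrow> complex) \<Rightarrow> complex) set" where
  "tempered_torus = {u.
     (\<forall>f\<in>schwartz_torus. \<forall>g\<in>schwartz_torus. u (\<lambda>z. f z + g z) = u f + u g) \<and>
     (\<forall>c. \<forall>f\<in>schwartz_torus. u (\<lambda>z. c * f z) = c * u f) \<and>
     (\<exists>C N. C > 0 \<and> N > 0 \<and> (\<forall>f\<in>schwartz_torus. norm (u f) \<le> C * p_torus N f))}"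

definition partial_fourier ::
    "(((real ^ 'm::finite) \<times> (real ^ 'n::finite) \<Rightarrow> complex) \<Rightarrow> complex) \<Rightarrow> int ^ 'm
      \<Rightarrow> (real ^ 'n \<Rightarrow> complex) \<Rightarrow> complex" where
  "partial_fourier u k f =
     of_real (1 / (2 * pi) ^ CARD('m)) * u (\<lambda>(t, x). exp (- \<i> * of_real (int_vec k \<bullet> t)) * f x)"

end

theory Submission
  imports Defs
begin

text \<open>The test function paired with \<open>u\<close> in the Fourier coefficient at \<open>k\<close> is the product of \<open>f\<close>
  with the character \<open>exp (- \<i> k \<bullet> t)\<close>. The continuity estimate of \<open>u\<close> applies to it, so the whole
  matter is to compare the torus seminorms of the product with the seminorms of \<open>f\<close>.

  The character is an eigenfunction of each \<open>\<partial>/\<partial>t\<^sub>i\<close>, with eigenvalue \<open>- \<i> k\<^sub>i\<close>, and the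
  derivatives in \<open>x\<close> only see \<open>f\<close>. Hence \<open>x\<^sup>\<gamma> \<partial>\<^sub>t\<^sup>\<alpha> \<partial>\<^sub>x\<^sup>\<beta>\<close> of the product has, at each point, the
  absolute value \<open>\<bar>k\<^sup>\<alpha>\<bar> \<bar>x\<^sup>\<gamma> \<partial>\<^sup>\<beta> f x\<bar>\<close> (\<open>norm_weighted_deriv_modulate\<close>). For
  \<open>\<bar>\<alpha>\<bar> \<le> N\<close> the first factor is at most \<open>(1 + \<bar>k\<bar>\<^sup>2)\<^bsup>N/2\<^esup>\<close> (\<open>abs_monomial_le\<close>). After
  this bound the summands no longer depend on \<open>\<alpha>\<close>, and summing over \<open>\<alpha>\<close> merely contributes the
  number of multi-indices of size at most \<open>N\<close> (\<open>p_torus_modulate_le\<close>). So the order \<open>N\<close> of \<open>u\<close>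
  serves for the Fourier coefficients as well.

  The same formulas show that the product is an admissible test function
  (\<open>modulate_in_schwartz_torus\<close>); here the periodicity uses that the frequency is integral.\<close>

section \<open>Calculus of smooth functions\<close>

lemma has_derivative_dir_deriv:
  "f differentiable (at z) \<Longrightarrow> (f has_derivative (\<lambda>v. dir_deriv v f z)) (at z)"
  unfolding dir_deriv_def using frechet_derivative_works by blast

lemma dir_derivI: "(\<And>z. (f has_derivative f' z) (at z)) \<Longrightarrow> dir_deriv v f = (\<lambda>z. f' z v)"
  unfolding dir_deriv_def using frechet_derivative_at by metis

text \<open>\<open>Ck\<close> asks for continuity only at the bottom of the recursion; at level \<open>0\<close> the step down is the
  continuity of differentiable functions.\<close>

lemma Ck_SucD: "Ck (Suc k) f \<Longrightarrow> Ck k f"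
proof (induction k arbitrary: f)
  case 0
  then show ?case
    by (auto simp: continuous_on_eq_continuous_at differentiable_imp_continuous_within)
next
  case (Suc k)
  then show ?case by (metis Ck.simps(2))
qed

text \<open>Closure under linear combinations is what the product rule requires: a derivative of a modulated
  function is the modulation of a linear combination of the function and one of its derivatives.\<close>

lemma Ck_lincomb: "Ck k f \<Longrightarrow> Ck k g \<Longrightarrow> Ck k (\<lambda>z. c * f z + g z)"
proof (induction k arbitrary: f g)
  case 0
  then show ?case by (auto intro!: continuous_intros)
next
  case (Suc k)
  have D: "((\<lambda>z. c * f z + g z) has_derivative (\<lambda>v. c * dir_deriv v f z + dir_deriv v g z)) (at z)"
    for z
    using Suc.prems by (intro derivative_intros has_derivative_dir_deriv) auto
  then have "dir_deriv v (\<lambda>z. c * f z + g z) = (\<lambda>z. c * dir_deriv v f z + dir_deriv v g z)" for v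
    by (rule dir_derivI)
  with D Suc show ?case by (auto simp: differentiable_def)
qed

lemma smooth_differentiable: "smooth f \<Longrightarrow> f differentiable (at z)"
  unfolding smooth_def by (metis Ck.simps(2))

lemma smooth_dir_deriv: "smooth f \<Longrightarrow> smooth (dir_deriv v f)"
  unfolding smooth_def by (metis Ck.simps(2))

section \<open>Modulation by a character\<close>

definition modulate ::
    "real ^ 'm::finite \<Rightarrow> (real ^ 'n::finite \<Rightarrow> complex) \<Rightarrow> (real ^ 'm) \<times> (real ^ 'n) \<Rightarrow> complex" where
  "modulate k h = (\<lambda>(t, x). exp (- \<i> * of_real (k \<bullet> t)) * h x)"

text \<open>The derivative in a fixed direction is again a modulated function. This is why smoothness and
  iterated derivatives can be handled by induction on \<open>h\<close> alone.\<close>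

lemma has_derivative_modulate:
  assumes "\<And>x. h differentiable (at x)"
  shows "(modulate k h has_derivative
    (\<lambda>v. modulate k (\<lambda>x. - \<i> * of_real (k \<bullet> fst v) * h x + dir_deriv (snd v) h x) z)) (at z)"
proof -
  have h: "((\<lambda>z. h (snd z)) has_derivative (\<lambda>v. dir_deriv (snd v) h (snd z))) (at z)"
    by (rule has_derivative_compose[OF has_derivative_snd[OF has_derivative_ident]])
       (rule has_derivative_dir_deriv[OF assms])
  have "((\<lambda>z. - \<i> * complex_of_real (k \<bullet> fst z)) has_derivative
      (\<lambda>v. - \<i> * complex_of_real (k \<bullet> fst v))) (at z)"
    by (intro derivative_intros)
  from has_derivative_compose[OF this DERIV_exp[unfolded has_field_derivative_def]]
  have "((\<lambda>z. exp (- \<i> * complex_of_real (k \<bullet> fst z))) has_derivative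
      (\<lambda>v. exp (- \<i> * complex_of_real (k \<bullet> fst z)) * (- \<i> * complex_of_real (k \<bullet> fst v)))) (at z)" .
  from has_derivative_mult[OF this h] show ?thesis
    unfolding modulate_def case_prod_unfold
    by (rule has_derivative_eq_rhs) (simp add: fun_eq_iff algebra_simps)
qed

lemma dir_deriv_modulate:
  assumes "\<And>x. h differentiable (at x)"
  shows "dir_deriv v (modulate k h)
    = modulate k (\<lambda>x. - \<i> * of_real (k \<bullet> fst v) * h x + dir_deriv (snd v) h x)"
  using has_derivative_modulate[OF assms] by (rule dir_derivI)

lemma Ck_modulate: "Ck j h \<Longrightarrow> Ck j (modulate k h)"
proof (induction j arbitrary: h)
  case 0
  then have "continuous_on UNIV (\<lambda>z. h (snd z))"
    by (intro continuous_on_compose2[OF _ continuous_on_snd[OF continuous_on_id]]) auto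
  then show ?case
    by (auto simp: modulate_def case_prod_unfold intro!: continuous_intros)
next
  case (Suc j)
  then have d: "\<And>x. h differentiable (at x)" by simp
  have "Ck j (dir_deriv v (modulate k h))" for v
    unfolding dir_deriv_modulate[OF d]
    using Suc.prems by (intro Suc.IH Ck_lincomb Ck_SucD[OF Suc.prems]) auto
  moreover have "modulate k h differentiable (at z)" for z
    using has_derivative_modulate[OF d] unfolding differentiable_def by blast
  ultimately show ?case by simp
qed

lemma smooth_modulate: "smooth h \<Longrightarrow> smooth (modulate k h)"
  by (simp add: smooth_def Ck_modulate)

lemma deriv_x_modulate:
  fixes k :: "real ^ 'm::finite" and h :: "real ^ 'n::finite \<Rightarrow> complex"
  assumes "smooth h"
  shows "deriv_x \<beta> (modulate k h) = modulate k (deriv_sp \<beta> h) \<and> smooth (deriv_sp \<beta> h)"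
proof -
  have pow: "(dir_deriv (0, w) ^^ j) (modulate k h) = modulate k ((dir_deriv w ^^ j) h)
      \<and> smooth ((dir_deriv w ^^ j) h)" if "smooth h" for w j and h :: "real ^ 'n \<Rightarrow> complex"
    using that
    by (induction j) (auto simp: smooth_dir_deriv dir_deriv_modulate smooth_differentiable)
  have "fold (\<lambda>i. dir_deriv (0, axis i 1) ^^ (\<beta> $ i)) is (modulate k h)
      = modulate k (fold (\<lambda>i. dir_deriv (axis i 1) ^^ (\<beta> $ i)) is h)
      \<and> smooth (fold (\<lambda>i. dir_deriv (axis i 1) ^^ (\<beta> $ i)) is h)" for "is"
    using assms by (induction "is" arbitrary: h) (auto simp: pow)
  then show ?thesis
    unfolding deriv_x_def deriv_sp_def mi_deriv_def by blast
qed

lemma coords_enumeration: "distinct (coords :: 'd::finite list)" "set (coords :: 'd list) = UNIV"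
proof -
  have "\<exists>is. distinct is \<and> set is = (UNIV :: 'd set)"
    using finite_distinct_list[of "UNIV :: 'd set"] by auto
  then have "distinct (coords :: 'd list) \<and> set (coords :: 'd list) = UNIV"
    unfolding coords_def by (rule someI_ex)
  then show "distinct (coords :: 'd list)" "set (coords :: 'd list) = UNIV" by auto
qed

text \<open>A direction in the torus factor acts on a modulated function as multiplication by a scalar, so
  the iterated derivative collects the monomial in the eigenvalues, whichever order of the
  coordinates is chosen.\<close>

lemma deriv_t_modulate:
  assumes "smooth h"
  shows "deriv_t \<alpha> (modulate k h) z = (\<Prod>i\<in>UNIV. (- \<i> * of_real (k $ i)) ^ (\<alpha> $ i)) * modulate k h z"
proof -
  have D: "dir_deriv (axis i 1, 0) (\<lambda>z. c * modulate k h z)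
      = (\<lambda>z. c * (- \<i> * of_real (k $ i)) * modulate k h z)" for c i
  proof -
    have "((\<lambda>z. c * modulate k h z) has_derivative (\<lambda>v. c *
      modulate k (\<lambda>x. - \<i> * of_real (k \<bullet> fst v) * h x + dir_deriv (snd v) h x) z)) (at z)" for z
      by (intro has_derivative_mult_right has_derivative_modulate smooth_differentiable assms)
    from dir_derivI[OF this]
    have "dir_deriv (axis i 1, 0) (\<lambda>z. c * modulate k h z) = (\<lambda>z. c *
      modulate k (\<lambda>x. - \<i> * of_real (k $ i) * h x + dir_deriv 0 h x) z)"
      by (simp add: inner_axis)
    moreover have "dir_deriv 0 h x = 0" for x
      using linear_0[OF has_derivative_linear[OF has_derivative_dir_deriv[OF smooth_differentiable[OF assms]]]] .
    ultimately show ?thesis by (auto simp: modulate_def)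
  qed
  have pow: "(dir_deriv (axis i 1, 0) ^^ j) (\<lambda>z. c * modulate k h z)
      = (\<lambda>z. c * (- \<i> * of_real (k $ i)) ^ j * modulate k h z)" for c i j
  proof (induction j)
    case (Suc j)
    show ?case unfolding funpow.simps o_apply Suc.IH D by (simp add: mult.assoc mult.left_commute)
  qed simp
  have "fold (\<lambda>i. dir_deriv (axis i 1, 0) ^^ (\<alpha> $ i)) is (\<lambda>z. c * modulate k h z)
      = (\<lambda>z. c * prod_list (map (\<lambda>i. (- \<i> * of_real (k $ i)) ^ (\<alpha> $ i)) is) * modulate k h z)"
    for "is" c
    by (induction "is" arbitrary: c) (simp_all add: pow flip: mult.assoc)
  from this[of coords 1] show ?thesis
    unfolding deriv_t_def mi_deriv_def
    by (simp add: prod.distinct_set_conv_list[OF coords_enumeration(1), symmetric] coords_enumeration(2))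
qed

section \<open>Seminorms of a modulated Schwartz function\<close>

lemma norm_modulate: "norm (modulate k h (t, x)) = norm (h x)"
  by (simp add: modulate_def norm_mult)

text \<open>The character has absolute value \<open>1\<close>, so all that remains of it is the factor produced by the
  derivatives in \<open>t\<close>.\<close>

lemma norm_weighted_deriv_modulate:
  assumes "smooth f"
  shows "norm (monomial \<gamma> x *\<^sub>R deriv_t \<alpha> (deriv_x \<beta> (modulate k f)) (t, x))
    = \<bar>monomial \<alpha> k\<bar> * norm (monomial \<gamma> x *\<^sub>R deriv_sp \<beta> f x)"
proof -
  have "norm (\<Prod>i\<in>UNIV. (- \<i> * of_real (k $ i)) ^ (\<alpha> $ i) :: complex) = \<bar>monomial \<alpha> k\<bar>"
    unfolding monomial_def abs_prod prod_norm[symmetric]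
    by (simp add: norm_mult norm_power power_abs)
  then show ?thesis
    using deriv_x_modulate[OF assms, of \<beta> k]
    by (simp add: deriv_t_modulate norm_mult norm_modulate)
qed

lemma bdd_above_schwartz:
  "f \<in> schwartz \<Longrightarrow> bdd_above (range (\<lambda>x. norm (monomial \<gamma> x *\<^sub>R deriv_sp \<beta> f x)))"
  by (simp add: schwartz_def)

text \<open>For integral \<open>k\<close> and \<open>l\<close>, translating \<open>t\<close> by \<open>2 \<pi> l\<close> changes the exponent by an integral
  multiple of \<open>2 \<pi> \<i>\<close>.\<close>

lemma torus_periodic_modulate: "torus_periodic (modulate (int_vec k) h)"
proof -
  have "exp (- \<i> * of_real (int_vec k \<bullet> (t + (2 * pi) *\<^sub>R int_vec l))) = exp (- \<i> * of_real (int_vec k \<bullet> t))"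
    for t and l :: "int ^ 'a"
  proof -
    have "int_vec k \<bullet> int_vec l = of_int (\<Sum>i\<in>UNIV. k $ i * l $ i)"
      by (simp add: int_vec_def inner_vec_def)
    then have "- \<i> * of_real (int_vec k \<bullet> (t + (2 * pi) *\<^sub>R int_vec l)) = - \<i> * of_real (int_vec k \<bullet> t)
        + of_int (2 * - (\<Sum>i\<in>UNIV. k $ i * l $ i)) * (of_real pi * \<i>)"
      by (simp add: inner_add_right algebra_simps)
    then show ?thesis
      unfolding exp_eq by (intro exI[of _ "- (\<Sum>i\<in>UNIV. k $ i * l $ i)"]) (simp add: mult_ac)
  qed
  then show ?thesis by (simp add: torus_periodic_def modulate_def)
qed

lemma modulate_in_schwartz_torus:
  assumes "f \<in> schwartz"
  shows "modulate (int_vec k) f \<in> schwartz_torus"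
proof -
  have sm: "smooth f" using assms by (simp add: schwartz_def)
  have "bdd_above (range (\<lambda>(t, x). norm (monomial \<gamma> x *\<^sub>R
      deriv_t \<alpha> (deriv_x \<beta> (modulate (int_vec k) f)) (t, x))))" for \<alpha> \<beta> \<gamma>
  proof -
    obtain B where "\<And>x. norm (monomial \<gamma> x *\<^sub>R deriv_sp \<beta> f x) \<le> B"
      using bdd_above_schwartz[OF assms, of \<gamma> \<beta>] by (auto simp: bdd_above_def)
    then show ?thesis
      unfolding case_prod_unfold norm_weighted_deriv_modulate[OF sm]
      by (intro bdd_aboveI2[where M = "\<bar>monomial \<alpha> (int_vec k)\<bar> * B"] mult_left_mono)
         (auto simp: norm_weighted_deriv_modulate[OF sm] simp del: norm_scaleR intro!: mult_left_mono)
  qed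
  then show ?thesis
    using sm by (simp only: schwartz_torus_def mem_Collect_eq torus_periodic_modulate smooth_modulate simp_thms)
qed

text \<open>Each factor \<open>\<bar>k\<^sub>i\<bar>\<close> is at most \<open>sqrt (1 + \<bar>k\<bar>\<^sup>2)\<close>. As this number is at least \<open>1\<close>, its power
  \<open>\<bar>\<alpha>\<bar>\<close> may be raised to the power \<open>N\<close>; with \<open>\<bar>k\<bar>\<close> itself that would fail for \<open>\<bar>k\<bar> < 1\<close>.\<close>

lemma abs_monomial_le:
  assumes "mi_size \<alpha> \<le> N"
  shows "\<bar>monomial \<alpha> k\<bar> \<le> (1 + (norm k)\<^sup>2) powr (real N / 2)"
proof -
  let ?r = "1 + (norm k)\<^sup>2"
  have "\<bar>monomial \<alpha> k\<bar> \<le> (\<Prod>i\<in>UNIV. sqrt ?r ^ (\<alpha> $ i))"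
    unfolding monomial_def abs_prod power_abs
  proof (intro prod_mono conjI power_mono)
    fix i
    show "\<bar>k $ i\<bar> \<le> sqrt ?r"
      using power_mono[OF component_le_norm_cart[of k i], of 2] by (intro real_le_rsqrt) simp
  qed auto
  also have "\<dots> = sqrt ?r ^ mi_size \<alpha>"
    by (simp add: mi_size_def power_sum)
  also have "\<dots> \<le> sqrt ?r ^ N"
    by (intro power_increasing assms) simp
  also have "\<dots> = ?r powr (real N / 2)"
  proof -
    have "0 < ?r" by (simp add: add_pos_nonneg)
    then show ?thesis
      by (simp add: powr_half_sqrt[symmetric] powr_powr powr_realpow[symmetric])
  qed
  finally show ?thesis .
qed

lemma seminorm_torus_modulate_le:
  assumes "f \<in> schwartz" and "mi_size \<alpha> \<le> N"
  shows "seminorm_torus \<alpha> \<beta> \<gamma> (modulate k f)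
    \<le> (1 + (norm k)\<^sup>2) powr (real N / 2) * (SUP x. norm (monomial \<gamma> x *\<^sub>R deriv_sp \<beta> f x))"
proof -
  have sm: "smooth f" using assms by (simp add: schwartz_def)
  have "norm (monomial \<gamma> x *\<^sub>R deriv_sp \<beta> f x) \<le> (SUP x. norm (monomial \<gamma> x *\<^sub>R deriv_sp \<beta> f x))" for x
    by (rule cSUP_upper[OF UNIV_I bdd_above_schwartz[OF assms(1)]])
  then have "\<bar>monomial \<alpha> k\<bar> * norm (monomial \<gamma> x *\<^sub>R deriv_sp \<beta> f x)
    \<le> (1 + (norm k)\<^sup>2) powr (real N / 2) * (SUP x. norm (monomial \<gamma> x *\<^sub>R deriv_sp \<beta> f x))" for x
    by (intro mult_mono abs_monomial_le assms) auto
  then show ?thesis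
    unfolding seminorm_torus_def
    by (intro cSUP_least) (auto simp: norm_weighted_deriv_modulate[OF sm] simp del: norm_scaleR)
qed

text \<open>Without finiteness the sums over multi-indices would be \<open>0\<close> by convention, and the estimates
  between them would say nothing.\<close>

lemma finite_mi_size_le: "finite {\<alpha> :: nat ^ 'd::finite. mi_size \<alpha> \<le> N}"
proof (rule finite_subset)
  show "{\<alpha> :: nat ^ 'd. mi_size \<alpha> \<le> N} \<subseteq> vec_lambda ` (UNIV \<rightarrow>\<^sub>E {..N})"
  proof
    fix \<alpha> :: "nat ^ 'd" assume "\<alpha> \<in> {\<alpha>. mi_size \<alpha> \<le> N}"
    moreover have "\<alpha> $ i \<le> mi_size \<alpha>" for i
      unfolding mi_size_def by (rule member_le_sum) auto
    ultimately have "vec_nth \<alpha> \<in> UNIV \<rightarrow>\<^sub>E {..N}"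
      by (auto intro: order_trans)
    then show "\<alpha> \<in> vec_lambda ` (UNIV \<rightarrow>\<^sub>E {..N})"
      by (metis imageI vec_nth_inverse)
  qed
qed (intro finite_imageI finite_PiE; simp)

lemma p_torus_modulate_le:
  fixes k :: "real ^ 'm::finite" and f :: "real ^ 'n::finite \<Rightarrow> complex"
  assumes f: "f \<in> schwartz"
  shows "p_torus N (modulate k f)
    \<le> card {\<alpha> :: nat ^ 'm. mi_size \<alpha> \<le> N} * ((1 + (norm k)\<^sup>2) powr (real N / 2) * p_tilde N f)"
proof -
  let ?A = "{\<alpha> :: nat ^ 'm. mi_size \<alpha> \<le> N}"
  let ?B = "{(\<beta> :: nat ^ 'n, \<gamma> :: nat ^ 'n). mi_size \<beta> + mi_size \<gamma> \<le> N}"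
  let ?T = "{(\<alpha> :: nat ^ 'm, \<beta> :: nat ^ 'n, \<gamma> :: nat ^ 'n). mi_size \<alpha> + mi_size \<beta> + mi_size \<gamma> \<le> N}"
  let ?R = "(1 + (norm k)\<^sup>2) powr (real N / 2)"
  define S where "S \<beta> \<gamma> = (SUP x. norm (monomial \<gamma> x *\<^sub>R deriv_sp \<beta> f x))" for \<beta> \<gamma>
  have S: "0 \<le> S \<beta> \<gamma>" for \<beta> \<gamma>
    unfolding S_def
    by (rule cSUP_upper2[OF bdd_above_schwartz[OF f] UNIV_I[of 0]]) simp
  have fin: "finite ?B"
    by (rule finite_subset[OF _ finite_cartesian_product[OF finite_mi_size_le[of N] finite_mi_size_le[of N]]])
       auto
  have "p_torus N (modulate k f) \<le> (\<Sum>(\<alpha>, \<beta>, \<gamma>)\<in>?T. ?R * S \<beta> \<gamma>)"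
    unfolding p_torus_def S_def
    by (intro sum_mono) (auto intro!: seminorm_torus_modulate_le f simp del: norm_scaleR)
  \<comment> \<open>Decoupling \<open>\<alpha>\<close> from \<open>\<beta>\<close> and \<open>\<gamma>\<close> enlarges the index set to a product.\<close>
  also have "\<dots> \<le> (\<Sum>(\<alpha>, \<beta>, \<gamma>)\<in>?A \<times> ?B. ?R * S \<beta> \<gamma>)"
    by (intro sum_mono2 finite_cartesian_product finite_mi_size_le fin) (auto simp: S)
  also have "\<dots> = (\<Sum>\<alpha>\<in>?A. \<Sum>(\<beta>, \<gamma>)\<in>?B. ?R * S \<beta> \<gamma>)"
    by (rule sum.cartesian_product[symmetric])
  also have "\<dots> = card ?A * (?R * p_tilde N f)"
    by (simp add: p_tilde_def S_def sum_distrib_left case_prod_unfold)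
  finally show ?thesis .
qed

section \<open>Growth of the partial Fourier coefficients\<close>

theorem proposition2p4:
  fixes u :: "((real ^ 'm::finite) \<times> (real ^ 'n::finite) \<Rightarrow> complex) \<Rightarrow> complex"
  assumes "u \<in> tempered_torus"
  shows "\<exists>(C::real) (N::nat). C > 0 \<and> N > 0 \<and>
    (\<forall>f\<in>schwartz. \<forall>k :: int ^ 'm.
       norm (partial_fourier u k f)
         \<le> C * p_tilde N f * (1 + (norm (int_vec k))\<^sup>2) powr (real N / 2))"
proof -
  obtain C :: real and N where C: "C > 0" and N: "N > 0"
    and u: "\<And>g. g \<in> schwartz_torus \<Longrightarrow> norm (u g) \<le> C * p_torus N g"
    using assms unfolding tempered_torus_def by blast
  let ?c = "1 / (2 * pi) ^ CARD('m)"
  let ?M = "card {\<alpha> :: nat ^ 'm. mi_size \<alpha> \<le> N}"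
  \<comment> \<open>The zero multi-index makes the count, and with it the constant, positive.\<close>
  have "0 \<in> {\<alpha> :: nat ^ 'm. mi_size \<alpha> \<le> N}" by (simp add: mi_size_def)
  then have "?M > 0" using finite_mi_size_le[of N] by (auto simp: card_gt_0_iff)
  then have "?c * C * ?M > 0" using C by simp
  moreover have "norm (partial_fourier u k f)
      \<le> ?c * C * ?M * p_tilde N f * (1 + (norm (int_vec k))\<^sup>2) powr (real N / 2)"
    if f: "f \<in> schwartz" for f and k :: "int ^ 'm"
  proof -
    have "norm (partial_fourier u k f) = ?c * norm (u (modulate (int_vec k) f))"
      by (simp add: partial_fourier_def modulate_def norm_mult norm_divide norm_power)
    also have "\<dots> \<le> ?c * (C * (?M * ((1 + (norm (int_vec k))\<^sup>2) powr (real N / 2) * p_tilde N f)))"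
      using C by (intro mult_left_mono order_trans[OF u[OF modulate_in_schwartz_torus[OF f]]]
          p_torus_modulate_le f) auto
    finally show ?thesis by (simp add: mult_ac)
  qed
  ultimately show ?thesis using N by blast
qed

end
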